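(* Let $\mathcal{H}$ be a real Hilbert space, let $S:\mathcal{H}\to 2^{\mathcal{H}}$ be maximal monotone, let $T:\mathcal{H}\to\mathcal{H}$ be monotone and Lipschitz continuous with constant $\mathsf{L}>0$, and assume that $(S+T)^{-1}(0)$ is nonempty. Let $\delta_0,\delta_1>0$, $\bar{\beta}\in(0,\frac14)$, $\bar{r}\in\left(\bar{\beta},\frac{1-2\bar{\beta}}{2}\right)$, let $\{\sigma_n\}_{n\ge1}$ be a sequence in $(0,1)$ and $\{c_n\}_{n\ge1}$ a sequence in $[0,\infty)$ with $\sum_{n=1}^\infty c_n<\infty$. For arbitrary $\hat{v},w_0,w_1\in\mathcal{H}$, let $\{w_n\}$ be generated by $$w_{n+1}=J^{S}_{\delta_n}\big(\sigma_n\hat{v}+(1-\sigma_n)w_n-\delta_nTw_n-\delta_{n-1}(1-\sigma_n)(Tw_n-Tw_{n-1})\big),\quad n\ge1,$$ where, for $n\ge 1$, $$\delta_{n+1}=\begin{cases}\min\left\{\dfrac{\bar{r}\|w_n-w_{n+1}\|}{\|Tw_n-Tw_{n+1}\|},\ \delta_n+c_n\right\},&\text{if }Tw_n\ne Tw_{n+1},\\ \delta_n+c_n,&\text{otherwise.}\end{cases}$$ If $\lim_{n\to\infty}\sigma_n=0$ and $\sum_{n=1}^\infty\sigma_n=\infty$, then $\{w_n\}$ converges strongly (i.e., in norm) to $P_{(S+T)^{-1}(0)}\hat{v}$.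
   Context: $(S+T)^{-1}(0)=\{w\in\mathcal{H}: 0\in Sw+Tw\}$. For $\delta>0$, $J^S_\delta=(I_{\mathcal{H}}+\delta S)^{-1}$ is the resolvent of $S$, which is single-valued and everywhere defined when $S$ is maximal monotone. A set-valued operator $S$ is monotone if $\langle \hat a-\hat b,a-b\rangle\ge0$ for all $a,b\in\mathcal{H}$, $\hat a\in Sa$, $\hat b\in Sb$, and maximal monotone if, in addition, its graph is not properly contained in the graph of any other monotone operator. $T$ is monotone if $\langle Ta-Tb,a-b\rangle\ge0$ for all $a,b$, and Lipschitz continuous with constant $\mathsf{L}$ if $\|Ta-Tb\|\le\mathsf{L}\|a-b\|$ for all $a,b$. $P_C$ denotes the metric projection onto a nonempty closed convex set $C\subseteq\mathcal{H}$ (the set $(S+T)^{-1}(0)$ is closed and convex because $S+T$ is maximal monotone). *)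

theory Defs
  imports "HOL-Analysis.Analysis"
begin

text \<open>Set-valued operators on a real Hilbert space \<open>'a\<close> are functions \<open>'a \<Rightarrow> 'a set\<close>.\<close>

definition op_graph :: "('a \<Rightarrow> 'a set) \<Rightarrow> ('a \<times> 'a) set" where
  "op_graph A = {(a, u). u \<in> A a}"

definition monotone_op :: "('a::real_inner \<Rightarrow> 'a set) \<Rightarrow> bool" where
  "monotone_op A \<longleftrightarrow> (\<forall>a b. \<forall>u\<in>A a. \<forall>v\<in>A b. inner (u - v) (a - b) \<ge> 0)"

definition maximal_monotone_op :: "('a::real_inner \<Rightarrow> 'a set) \<Rightarrow> bool" where
  "maximal_monotone_op A \<longleftrightarrow>
     monotone_op A \<and> \<not> (\<exists>B. monotone_op B \<and> op_graph A \<subset> op_graph B)"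

definition op_inverse :: "('a \<Rightarrow> 'a set) \<Rightarrow> 'a \<Rightarrow> 'a set" where
  "op_inverse A u = {a. u \<in> A a}"

text \<open>The resolvent as a single-valued map: \<open>resolvent \<delta> A x\<close> is the unique element of
  \<open>(I + \<delta> A)\<^sup>-\<^sup>1 x\<close>. It is unspecified when that set is not a singleton, which does not happen
  for maximal monotone \<open>A\<close> and \<open>\<delta> > 0\<close> on a Hilbert space (Minty).\<close>

definition resolvent :: "real \<Rightarrow> ('a::real_inner \<Rightarrow> 'a set) \<Rightarrow> 'a \<Rightarrow> 'a" where
  "resolvent \<delta> A x = (THE p. p \<in> op_inverse (\<lambda>a. {a} + (\<lambda>u. \<delta> *\<^sub>R u) ` A a) x)"

text \<open>The library's \<^term>\<open>closest_point\<close> is restricted to \<open>heine_borel\<close> types and hence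
  to finite dimension.\<close>

definition metric_proj :: "'a::metric_space set \<Rightarrow> 'a \<Rightarrow> 'a" where
  "metric_proj C x = (THE p. p \<in> C \<and> (\<forall>y\<in>C. dist x p \<le> dist x y))"

end

theory Submission
  imports Defs
begin

text \<open>
  Let \<open>A = S + T\<close>, which is maximal monotone, let \<open>p\<close> be the projection of \<open>v\<close> onto its zeros, and put
  \<open>y\<^sub>n = \<delta>\<^sub>n\<^sub>-\<^sub>1 (T w\<^sub>n - T w\<^sub>n\<^sub>-\<^sub>1)\<close>, \<open>d\<^sub>n = w\<^sub>n\<^sub>+\<^sub>1 - w\<^sub>n\<close>. The step sizes converge to a positive limit, so
  \<open>\<parallel>y\<^sub>n\<^sub>+\<^sub>1\<parallel> \<le> \<rho> \<parallel>d\<^sub>n\<parallel>\<close> eventually, for some \<open>\<rho> < 1/2\<close>. With \<open>\<rho>' \<in> (\<rho>, 1/2)\<close> the Lyapunov quantity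
  \<open>a\<^sub>n = \<parallel>w\<^sub>n - p\<parallel>\<^sup>2 - 2 \<langle>y\<^sub>n, w\<^sub>n - p\<rangle> + \<rho>' \<parallel>d\<^sub>n\<^sub>-\<^sub>1\<parallel>\<^sup>2\<close> dominates \<open>\<parallel>w\<^sub>n - p\<parallel>\<^sup>2 / 2\<close>, and monotonicity of \<open>A\<close> gives
  \<open>a\<^sub>n\<^sub>+\<^sub>1 \<le> (1 - \<sigma>\<^sub>n) a\<^sub>n - \<kappa> (\<parallel>d\<^sub>n\<^sub>-\<^sub>1\<parallel>\<^sup>2 + \<parallel>d\<^sub>n\<parallel>\<^sup>2) + 2 \<sigma>\<^sub>n \<langle>v - p, w\<^sub>n\<^sub>+\<^sub>1 - p\<rangle> - \<sigma>\<^sub>n \<parallel>w\<^sub>n\<^sub>+\<^sub>1 - p\<parallel>\<^sup>2\<close>.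
  If the increments \<open>d\<^sub>n\<^sub>-\<^sub>1\<close>, \<open>d\<^sub>n\<close> are small, then \<open>w\<^sub>n\<^sub>+\<^sub>1\<close> is an approximate zero of \<open>A\<close> and
  \<open>\<langle>v - p, w\<^sub>n\<^sub>+\<^sub>1 - p\<rangle>\<close> is at most \<open>\<epsilon>\<close>; if not, the \<open>\<kappa>\<close>-term absorbs the inner product because
  \<open>\<sigma>\<^sub>n \<rightarrow> 0\<close>. Either way \<open>a\<^sub>n\<^sub>+\<^sub>1 \<le> (1 - \<sigma>\<^sub>n) a\<^sub>n + \<sigma>\<^sub>n \<epsilon>\<close> eventually, whence \<open>a\<^sub>n \<rightarrow> 0\<close>.

  Weak compactness is not needed: the bound on approximate zeros comes from comparing them with
  the strongly convergent resolvent path \<open>(I + \<lambda> A)\<^sup>-\<^sup>1 v \<rightarrow> p\<close> as \<open>\<lambda> \<rightarrow> \<infinity>\<close>.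
\<close>

section \<open>Maximal monotone operators and Minty's theorem\<close>

lemma monotone_opD:
  assumes "monotone_op A" "u \<in> A a" "v \<in> A b"
  shows "inner (u - v) (a - b) \<ge> 0"
  using assms unfolding monotone_op_def by blast

text \<open>A pair monotonically related to the whole graph can be adjoined to it without losing
  monotonicity, so maximality already contains it; conversely, every point of a larger monotone
  graph is related to the smaller one. This pointwise test replaces graph extensions in all later
  arguments.\<close>

lemma maximal_monotone_op_iff:
  "maximal_monotone_op A \<longleftrightarrow> monotone_op A \<and>
     (\<forall>a u. (\<forall>b. \<forall>v\<in>A b. inner (u - v) (a - b) \<ge> 0) \<longrightarrow> u \<in> A a)"
proof (intro iffI conjI allI impI)
  assume max: "maximal_monotone_op A"
  then show mono: "monotone_op A" by (simp add: maximal_monotone_op_def)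
  fix a u assume rel: "\<forall>b. \<forall>v\<in>A b. inner (u - v) (a - b) \<ge> 0"
  define B where "B = A(a := insert u (A a))"
  have rel': "\<forall>b. \<forall>v\<in>A b. inner (v - u) (b - a) \<ge> 0"
    using rel by (metis inner_minus_left inner_minus_right minus_diff_eq minus_minus)
  have B: "v \<in> B b \<longleftrightarrow> v \<in> A b \<or> (b = a \<and> v = u)" for v b
    by (auto simp: B_def)
  have "monotone_op B"
    unfolding monotone_op_def using rel rel' monotone_opD[OF mono] by (auto simp: B)
  moreover have "op_graph A \<subset> op_graph B" if "u \<notin> A a"
    using that by (auto simp: op_graph_def B)
  ultimately show "u \<in> A a"
    using max unfolding maximal_monotone_op_def by blast
next
  assume A: "monotone_op A \<and> (\<forall>a u. (\<forall>b. \<forall>v\<in>A b. inner (u - v) (a - b) \<ge> 0) \<longrightarrow> u \<in> A a)"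
  show "maximal_monotone_op A"
    unfolding maximal_monotone_op_def
  proof (intro conjI notI)
    assume "\<exists>B. monotone_op B \<and> op_graph A \<subset> op_graph B"
    then obtain B where B: "monotone_op B" and sub: "op_graph A \<subset> op_graph B" by blast
    from sub have le: "v \<in> B b" if "v \<in> A b" for v b
      using that by (auto simp: op_graph_def)
    from sub obtain a u where "u \<in> B a" "u \<notin> A a"
      by (auto simp: op_graph_def)
    moreover from this have "\<forall>b. \<forall>v\<in>A b. inner (u - v) (a - b) \<ge> 0"
      using monotone_opD[OF B] le by blast
    ultimately show False using A by blast
  qed (use A in blast)
qed

lemma maximal_monotone_opD:
  assumes "maximal_monotone_op A" "\<And>b v. v \<in> A b \<Longrightarrow> inner (u - v) (a - b) \<ge> 0"
  shows "u \<in> A a"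
  using assms by (simp add: maximal_monotone_op_iff)

lemma maximal_monotone_op_imp_monotone_op: "maximal_monotone_op A \<Longrightarrow> monotone_op A"
  by (simp add: maximal_monotone_op_def)

section \<open>Minimizers of strongly convex functions\<close>

lemma norm_convex_combination_sq:
  fixes p q :: "'b::real_inner"
  shows "(norm ((1 - t) *\<^sub>R p + t *\<^sub>R q))\<^sup>2
    = (1 - t) * (norm p)\<^sup>2 + t * (norm q)\<^sup>2 - t * (1 - t) * (norm (p - q))\<^sup>2"
  unfolding power2_norm_eq_inner
  by (simp add: inner_add inner_diff inner_commute algebra_simps)

text \<open>Think of \<open>C m\<close> as \<open>{F \<le> m}\<close> for an extended-valued,
  1-strongly convex, lower semicontinuous \<open>F\<close>; the premise \<open>cont\<close> says
  that \<open>F \<le> k\<close> for all \<open>k > m\<close> gives \<open>F \<le> m\<close>. Strong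
  convexity shrinks the diameters of the sublevel sets near the infimum, so a nested sequence of
  them meets in a minimizer.\<close>

lemma strongly_convex_sublevels_have_minimizer:
  fixes C :: "real \<Rightarrow> 'b::{real_inner, complete_space} set"
  assumes closed: "\<And>m. closed (C m)"
    and mono: "\<And>m k. m \<le> k \<Longrightarrow> C m \<subseteq> C k"
    and cont: "\<And>m. (\<Inter>k\<in>{m<..}. C k) \<subseteq> C m"
    and ne: "C k \<noteq> {}"
    and bdd: "\<And>m. C m \<noteq> {} \<Longrightarrow> b \<le> m"
    and convex: "\<And>m k p q t. p \<in> C m \<Longrightarrow> q \<in> C k \<Longrightarrow> 0 \<le> t \<Longrightarrow> t \<le> 1 \<Longrightarrow>
      (1 - t) *\<^sub>R p + t *\<^sub>R q \<in> C ((1 - t) * m + t * k - t * (1 - t) / 2 * (norm (p - q))\<^sup>2)"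
  obtains \<mu> p where "p \<in> C \<mu>"
    and "\<And>q k. q \<in> C k \<Longrightarrow> \<mu> + (norm (p - q))\<^sup>2 / 2 \<le> k"
proof -
  define \<mu> where "\<mu> = Inf {m. C m \<noteq> {}}"
  have bb: "bdd_below {m. C m \<noteq> {}}" using bdd by (intro bdd_belowI[of _ b]) auto
  have \<mu>: "\<mu> \<le> m" if "p \<in> C m" for m p
    unfolding \<mu>_def using that by (intro cInf_lower bb) auto
  have ex: "C m \<noteq> {}" if "m > \<mu>" for m
  proof -
    have "{m. C m \<noteq> {}} \<noteq> {}" using ne by auto
    from cInf_lessD[OF this that[unfolded \<mu>_def]] obtain x where "C x \<noteq> {}" "x < m" by auto
    then show ?thesis using mono[of x m] by auto
  qed
  \<comment> \<open>The midpoint of \<open>p\<close> and \<open>q\<close> lies at level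
    \<open>m - (norm (p - q))\<^sup>2 / 8\<close>, which cannot be below
    \<open>\<mu>\<close>.\<close>
  have diam: "(norm (p - q))\<^sup>2 \<le> 8 * (m - \<mu>)" if "p \<in> C m" "q \<in> C m" for p q m
    using \<mu>[OF convex[OF that, of "1/2"]] by (simp add: field_simps)
  define D where "D n = C (\<mu> + inverse (real (Suc n)))" for n
  obtain p where p: "p \<in> D n" for n
  proof (rule decreasing_closed_nest[of D])
    show "closed (D n)" for n unfolding D_def by (rule closed)
    show "D n \<noteq> {}" for n unfolding D_def by (rule ex) simp
    show "D n \<subseteq> D m" if "m \<le> n" for m n
      unfolding D_def using that by (intro mono) (simp add: field_simps)
    fix e :: real assume e: "e > 0"
    then have "e\<^sup>2 / 8 > 0" by simp
    then obtain n where n: "inverse (real (Suc n)) < e\<^sup>2 / 8" using reals_Archimedean by blast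
    have "dist x y < e" if "x \<in> D n" "y \<in> D n" for x y
    proof -
      have "(dist x y)\<^sup>2 < e\<^sup>2"
        using diam[of x _ y] that n unfolding D_def by (fastforce simp: dist_norm)
      then show ?thesis using e by (simp add: power_less_imp_less_base)
    qed
    then show "\<exists>n. \<forall>x\<in>D n. \<forall>y\<in>D n. dist x y < e" by blast
  qed blast+
  have "p \<in> C k" if "k > \<mu>" for k
  proof -
    obtain n where "inverse (real (Suc n)) < k - \<mu>"
      using reals_Archimedean[of "k - \<mu>"] \<open>k > \<mu>\<close> by auto
    then have "D n \<subseteq> C k" unfolding D_def by (intro mono) simp
    then show ?thesis using p by blast
  qed
  then have pC: "p \<in> C \<mu>" using cont by blast
  have "\<mu> + (norm (p - q))\<^sup>2 / 2 \<le> k" if "q \<in> C k" for q k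
  proof -
    \<comment> \<open>Minimality is tested at the point a fraction \<open>t\<close> of the way from
      \<open>p\<close> to \<open>q\<close>. After division by \<open>t\<close> a factor
      \<open>1 - t\<close> remains, removed by letting \<open>t\<close> tend to 0.\<close>
    have *: "(1 - t) * ((norm (p - q))\<^sup>2 / 2) \<le> k - \<mu>" if "t \<in> {0<..<1}" for t
    proof -
      have "t * ((1 - t) * ((norm (p - q))\<^sup>2 / 2)) \<le> t * (k - \<mu>)"
        using \<mu>[OF convex[OF pC \<open>q \<in> C k\<close>, of t]] that by (simp add: algebra_simps)
      then show ?thesis using that by simp
    qed
    have "((\<lambda>t. (1 - t) * ((norm (p - q))\<^sup>2 / 2)) \<longlongrightarrow> (1 - 0) * ((norm (p - q))\<^sup>2 / 2)) (at_right 0)"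
      by (intro tendsto_intros)
    moreover have "eventually (\<lambda>t::real. (1 - t) * ((norm (p - q))\<^sup>2 / 2) \<le> k - \<mu>) (at_right 0)"
      unfolding eventually_at_right_field using * by (intro exI[of _ 1]) auto
    ultimately have "(1 - 0) * ((norm (p - q))\<^sup>2 / 2) \<le> k - \<mu>"
      by (intro tendsto_upperbound) auto
    then show ?thesis by simp
  qed
  with pC show thesis by (rule that)
qed

text \<open>The Fitzpatrick function \<open>F (a, a') = sup {\<langle>a, u\<rangle> + \<langle>y, a'\<rangle> - \<langle>y, u\<rangle> | u \<in> A y}\<close> of a maximal monotone
  \<open>A\<close> satisfies \<open>F (a, a') \<ge> \<langle>a, a'\<rangle>\<close>, with equality on the graph. If \<open>(a, a')\<close> minimizes the strongly
  convex function \<open>F + \<parallel>\<cdot>\<parallel>\<^sup>2 / 2\<close>, comparing with graph points shows that \<open>(- a', - a)\<close> is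
  monotonically related to the graph, and then that \<open>a' = - a\<close>. Since \<open>F\<close> may be infinite, the proof
  works with the sublevel sets \<open>C m\<close>.\<close>

lemma maximal_monotone_op_ex_fixpoint_uminus:
  fixes A :: "'a::{real_inner, complete_space} \<Rightarrow> 'a set"
  assumes max: "maximal_monotone_op A"
  shows "\<exists>x. - x \<in> A x"
proof -
  note mono = monotone_opD[OF maximal_monotone_op_imp_monotone_op[OF max]]
  define h where "h y u p = inner (fst p) u + inner y (snd p) - inner y u + (norm p)\<^sup>2 / 2"
    for y u :: 'a and p :: "'a \<times> 'a"
  define C where "C m = {p. \<forall>(y, u)\<in>op_graph A. h y u p \<le> m}" for m
  have C: "p \<in> C m \<longleftrightarrow> (\<forall>y. \<forall>u\<in>A y. h y u p \<le> m)" for p m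
    by (auto simp: C_def op_graph_def)
  have hgap: "h y u (a, a') = inner a a' - inner (a' - u) (a - y) + (norm (a, a'))\<^sup>2 / 2" for y u a a'
    by (simp add: h_def inner_diff inner_commute)
  have sq: "(norm (a, a'))\<^sup>2 / 2 + inner a a' = (norm (a + a'))\<^sup>2 / 2" for a a' :: 'a
    by (simp add: power2_norm_eq_inner inner_Pair inner_add inner_commute add_divide_distrib)
  have graph: "(y, u) \<in> C ((norm (y + u))\<^sup>2 / 2)" if "u \<in> A y" for y u
    unfolding C hgap sq[symmetric] using mono[OF that] by auto
  \<comment> \<open>If this failed, \<open>(a, a')\<close> would be strictly related to every graph
    point, hence itself in the graph by maximality, and testing it against itself would give
    \<open>0 > 0\<close>.\<close>
  have lower: "inner a a' + (norm (a, a'))\<^sup>2 / 2 \<le> m" if "(a, a') \<in> C m" for a a' m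
  proof (rule ccontr)
    assume "\<not> ?thesis"
    then have pos: "inner (a' - u) (a - y) > 0" if "u \<in> A y" for y u
      using \<open>(a, a') \<in> C m\<close> that unfolding C hgap by fastforce
    then have "a' \<in> A a" by (intro maximal_monotone_opD[OF max]) (simp add: less_imp_le)
    from pos[OF this] show False by simp
  qed
  \<comment> \<open>With an empty graph, the pair \<open>(0, 0)\<close> would be vacuously related
    to it and so belong to it.\<close>
  obtain y0 u0 where yu0: "u0 \<in> A y0"
    using maximal_monotone_opD[OF max, of 0 0] by blast
  obtain \<mu> p where p: "p \<in> C \<mu>"
    and min: "\<And>q k. q \<in> C k \<Longrightarrow> \<mu> + (norm (p - q))\<^sup>2 / 2 \<le> k"
  proof (rule strongly_convex_sublevels_have_minimizer[of C])
    have "C m = (\<Inter>(y, u)\<in>op_graph A. {p. h y u p \<le> m})" for m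
      by (auto simp: C_def)
    then show "closed (C m)" for m
      by (auto simp: h_def intro!: closed_INT closed_Collect_le continuous_intros)
    show "C m \<subseteq> C k" if "m \<le> k" for m k using that by (fastforce simp: C)
    show "(\<Inter>k\<in>{m<..}. C k) \<subseteq> C m" for m
    proof
      fix p assume "p \<in> (\<Inter>k\<in>{m<..}. C k)"
      then have "h y u p \<le> k" if "u \<in> A y" "m < k" for y u k using that by (simp add: C)
      then show "p \<in> C m" unfolding C by (blast intro: dense_ge)
    qed
    show "C ((norm (y0 + u0))\<^sup>2 / 2) \<noteq> {}" using graph[OF yu0] by blast
    show "0 \<le> m" if "C m \<noteq> {}" for m
    proof -
      obtain q where "q \<in> C m" using \<open>C m \<noteq> {}\<close> by blast
      then obtain a a' where "(a, a') \<in> C m" by (cases q) blast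
      from lower[OF this] sq[of a a'] zero_le_power2[of "norm (a + a')"] show ?thesis
        by linarith
    qed
    fix m k p q and t :: real
    assume pq: "p \<in> C m" "q \<in> C k" and t: "0 \<le> t" "t \<le> 1"
    have "h y u ((1 - t) *\<^sub>R p + t *\<^sub>R q)
        = (1 - t) * h y u p + t * h y u q - t * (1 - t) / 2 * (norm (p - q))\<^sup>2" for y u
      unfolding h_def norm_convex_combination_sq
      by (simp add: inner_add inner_diff field_simps)
    moreover have "(1 - t) * h y u p + t * h y u q \<le> (1 - t) * m + t * k" if "u \<in> A y" for y u
      using pq t that unfolding C by (intro add_mono mult_left_mono) auto
    ultimately show "(1 - t) *\<^sub>R p + t *\<^sub>R q \<in> C ((1 - t) * m + t * k - t * (1 - t) / 2 * (norm (p - q))\<^sup>2)"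
      by (simp add: C)
  qed blast
  obtain a a' where p_eq: "p = (a, a')" by (cases p)
  \<comment> \<open>The lower bound for \<open>\<mu>\<close> is inserted into the quadratic growth
    inequality at the graph point \<open>(y, u)\<close> and everything is doubled. At
    \<open>(y, u) = (- a', - a)\<close> the right-hand side vanishes.\<close>
  have key: "(norm (a + a'))\<^sup>2 \<le> inner (- a - u) (- a' - y)" if "u \<in> A y" for y u
  proof -
    have "2 * inner a a' + (norm p)\<^sup>2 + (norm (p - (y, u)))\<^sup>2 \<le> (norm (y + u))\<^sup>2"
      using lower[of a a' \<mu>] p min[OF graph[OF that]] by (simp add: p_eq)
    then show ?thesis
      unfolding p_eq
      by (simp add: power2_norm_eq_inner inner_Pair inner_add inner_diff inner_commute algebra_simps)
  qed
  have mem: "- a \<in> A (- a')"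
    by (intro maximal_monotone_opD[OF max]) (use key zero_le_power2 order_trans in blast)
  from key[OF this] have "a' = - a" by (simp add: add_eq_0_iff)
  with mem show ?thesis by auto
qed

text \<open>Scaling by \<open>\<delta>\<close> and translating by \<open>- z\<close> preserve
  maximal monotonicity, and \<open>- x \<in> B x\<close> for the resulting operator \<open>B\<close>
  is exactly the equation to be solved.\<close>

lemma minty:
  fixes A :: "'a::{real_inner, complete_space} \<Rightarrow> 'a set"
  assumes max: "maximal_monotone_op A" and "\<delta> > 0"
  obtains x u where "u \<in> A x" "x + \<delta> *\<^sub>R u = z"
proof -
  define B where "B x = (\<lambda>u. \<delta> *\<^sub>R u - z) ` A x" for x
  have "maximal_monotone_op B"
    unfolding maximal_monotone_op_iff
  proof (intro conjI allI impI)
    show "monotone_op B"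
      using monotone_opD[OF maximal_monotone_op_imp_monotone_op[OF max]] \<open>\<delta> > 0\<close>
      by (auto simp: monotone_op_def B_def simp flip: scaleR_diff_right)
    fix a u assume rel: "\<forall>b. \<forall>v\<in>B b. inner (u - v) (a - b) \<ge> 0"
    define u' where "u' = (u + z) /\<^sub>R \<delta>"
    have u: "u = \<delta> *\<^sub>R u' - z" using \<open>\<delta> > 0\<close> by (simp add: u'_def)
    have "u' \<in> A a"
    proof (rule maximal_monotone_opD[OF max])
      fix b v assume "v \<in> A b"
      then have "inner (u - (\<delta> *\<^sub>R v - z)) (a - b) \<ge> 0" using rel by (auto simp: B_def)
      then have "inner (\<delta> *\<^sub>R (u' - v)) (a - b) \<ge> 0" by (simp add: u scaleR_diff_right)
      then show "inner (u' - v) (a - b) \<ge> 0" using \<open>\<delta> > 0\<close> by (simp add: zero_le_mult_iff)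
    qed
    then show "u \<in> B a" by (auto simp: B_def u)
  qed
  then obtain x where "- x \<in> B x" using maximal_monotone_op_ex_fixpoint_uminus by blast
  then obtain u where "u \<in> A x" "- x = \<delta> *\<^sub>R u - z" by (auto simp: B_def)
  then have "\<delta> *\<^sub>R u = - x + z" by (simp only: eq_diff_eq)
  then have "x + \<delta> *\<^sub>R u = z" by simp
  with \<open>u \<in> A x\<close> show thesis by (rule that)
qed

section \<open>Resolvents and Lipschitz perturbations\<close>

lemma resolvent_nonexpansive:
  assumes "monotone_op A" "u \<in> A x" "v \<in> A y" "\<delta> > 0"
  shows "norm (x - y) \<le> norm ((x + \<delta> *\<^sub>R u) - (y + \<delta> *\<^sub>R v))"
proof -
  let ?d = "(x + \<delta> *\<^sub>R u) - (y + \<delta> *\<^sub>R v)"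
  have "inner ?d (x - y) = (norm (x - y))\<^sup>2 + \<delta> * inner (u - v) (x - y)"
    by (simp add: power2_norm_eq_inner inner_diff inner_add algebra_simps)
  moreover have "\<delta> * inner (u - v) (x - y) \<ge> 0"
    using monotone_opD[OF assms(1-3)] \<open>\<delta> > 0\<close> by simp
  ultimately have "(norm (x - y))\<^sup>2 \<le> norm ?d * norm (x - y)"
    using norm_cauchy_schwarz[of ?d "x - y"] by linarith
  then show ?thesis by (cases "x = y") (auto simp: power2_eq_square)
qed

lemma resolvent_unique:
  assumes "monotone_op A" "u \<in> A x" "v \<in> A y" "\<delta> > 0" "x + \<delta> *\<^sub>R u = y + \<delta> *\<^sub>R v"
  shows "x = y"
  using resolvent_nonexpansive[OF assms(1-4)] assms(5) by simp

lemma resolvent_works: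
  fixes A :: "'a::{real_inner, complete_space} \<Rightarrow> 'a set"
  assumes max: "maximal_monotone_op A" and "\<delta> > 0"
  obtains u where "u \<in> A (resolvent \<delta> A z)" "resolvent \<delta> A z + \<delta> *\<^sub>R u = z"
proof -
  have *: "p \<in> op_inverse (\<lambda>a. {a} + (\<lambda>u. \<delta> *\<^sub>R u) ` A a) z \<longleftrightarrow> (\<exists>u\<in>A p. p + \<delta> *\<^sub>R u = z)" for p
    by (auto simp: op_inverse_def set_plus_def)
  have "\<exists>!p. \<exists>u\<in>A p. p + \<delta> *\<^sub>R u = z"
    using minty[OF assms, of z] resolvent_unique[OF maximal_monotone_op_imp_monotone_op[OF max] _ _ \<open>\<delta> > 0\<close>]
    by metis
  from theI'[OF this] show thesis using that by (auto simp: resolvent_def *)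
qed

text \<open>Converse of Minty's theorem: for a pair \<open>(a, u)\<close> related to the graph,
  solve the equation with right-hand side \<open>a + \<delta> *\<^sub>R u\<close>. Relatedness to
  the solution forces it to be \<open>a\<close> with value \<open>u\<close>.\<close>

lemma maximal_monotone_opI_range:
  assumes mono: "monotone_op A" and "\<delta> > 0"
    and range: "\<And>z. \<exists>x. \<exists>u\<in>A x. x + \<delta> *\<^sub>R u = z"
  shows "maximal_monotone_op A"
  unfolding maximal_monotone_op_iff
proof (intro conjI allI impI mono)
  fix a u assume rel: "\<forall>b. \<forall>v\<in>A b. inner (u - v) (a - b) \<ge> 0"
  obtain x u' where u': "u' \<in> A x" and eq: "x + \<delta> *\<^sub>R u' = a + \<delta> *\<^sub>R u" using range by blast
  have "\<delta> * inner (u - u') (a - x) \<ge> 0" using rel u' \<open>\<delta> > 0\<close> by simp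
  moreover have "\<delta> *\<^sub>R (u - u') = x - a" using eq by (simp add: algebra_simps)
  ultimately have "inner (x - a) (a - x) \<ge> 0" by (metis inner_scaleR_left)
  then have "(norm (x - a))\<^sup>2 \<le> 0"
    by (simp add: power2_norm_eq_inner inner_diff algebra_simps)
  then have "x = a" by simp
  with eq \<open>\<delta> > 0\<close> u' show "u \<in> A a" by simp
qed

text \<open>By the range criterion it suffices to solve \<open>x + t *\<^sub>R (u + T x) = z\<close>
  with \<open>u \<in> S x\<close>. The solutions are the fixed points of \<open>f\<close>, and
  \<open>t = 1 / (2 * L)\<close> makes \<open>f\<close> a contraction with factor 1/2.\<close>

lemma maximal_monotone_op_plus_lipschitz:
  fixes S :: "'a::{real_inner, complete_space} \<Rightarrow> 'a set"
  assumes max: "maximal_monotone_op S"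
    and T: "\<And>a b. inner (T a - T b) (a - b) \<ge> 0"
    and lip: "L-lipschitz_on UNIV T" and "L > 0"
  shows "maximal_monotone_op (\<lambda>x. S x + {T x})"
proof (rule maximal_monotone_opI_range)
  note mono = maximal_monotone_op_imp_monotone_op[OF max]
  have "inner (u + T a - (u' + T b)) (a - b) \<ge> 0" if "u \<in> S a" "u' \<in> S b" for u u' a b
    using monotone_opD[OF mono that] T[of a b] by (simp add: inner_diff inner_add)
  then show "monotone_op (\<lambda>x. S x + {T x})"
    by (auto simp: monotone_op_def set_plus_def)
  define t where "t = 1 / (2 * L)"
  show t: "t > 0" using \<open>L > 0\<close> by (simp add: t_def)
  fix z
  define f where "f x = resolvent t S (z - t *\<^sub>R T x)" for x
  have "dist (f x) (f y) \<le> 1/2 * dist x y" for x y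
  proof -
    obtain u where u: "u \<in> S (f x)" "f x + t *\<^sub>R u = z - t *\<^sub>R T x"
      using resolvent_works[OF max t] unfolding f_def by metis
    obtain u' where u': "u' \<in> S (f y)" "f y + t *\<^sub>R u' = z - t *\<^sub>R T y"
      using resolvent_works[OF max t] unfolding f_def by metis
    have "dist (f x) (f y) \<le> norm (t *\<^sub>R (T y - T x))"
      using resolvent_nonexpansive[OF mono u(1) u'(1) t] unfolding u u' 
      by (simp add: dist_norm scaleR_diff_right)
    also have "\<dots> = t * dist (T x) (T y)" using t by (simp add: dist_norm norm_minus_commute)
    also have "\<dots> \<le> t * (L * dist x y)"
      using t lipschitz_onD[OF lip, of x y] by (intro mult_left_mono) auto
    finally show ?thesis using \<open>L > 0\<close> by (simp add: t_def)
  qed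
  then obtain x where x: "f x = x"
    using banach_fix_type[of "1/2" f] by auto
  obtain u where "u \<in> S x" "x + t *\<^sub>R u = z - t *\<^sub>R T x"
    using resolvent_works[OF max t, of "z - t *\<^sub>R T x"] x unfolding f_def by metis
  then show "\<exists>x. \<exists>u\<in>S x + {T x}. x + t *\<^sub>R u = z"
    by (intro exI[of _ x] bexI[of _ "u + T x"]) (auto simp: algebra_simps set_plus_def)
qed

lemma maximal_monotone_op_closed_graph:
  assumes max: "maximal_monotone_op A" and u: "\<And>n. u n \<in> A (x n)"
    and lim: "x \<longlonglongrightarrow> a" "u \<longlonglongrightarrow> b"
  shows "b \<in> A a"
proof (rule maximal_monotone_opD[OF max])
  fix y v assume "v \<in> A y"
  have "(\<lambda>n. inner (u n - v) (x n - y)) \<longlonglongrightarrow> inner (b - v) (a - y)"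
    by (intro tendsto_intros lim)
  then show "inner (b - v) (a - y) \<ge> 0"
    using monotone_opD[OF maximal_monotone_op_imp_monotone_op[OF max] u \<open>v \<in> A y\<close>]
    by (intro LIMSEQ_le_const) auto
qed

section \<open>Zeros, approximate zeros and the resolvent path\<close>

text \<open>The distances from \<open>v\<close> to the resolvent points grow with the parameter but
  stay below the distance to any zero, and their increments control \<open>norm (x m - x n)\<close>,
  so the path is Cauchy. Since \<open>u n\<close> is \<open>v - x n\<close> divided by
  \<open>Suc n\<close>, it tends to 0 and the limit is a zero.\<close>

lemma resolvent_path_converges:
  fixes A :: "'a::{real_inner, complete_space} \<Rightarrow> 'a set"
  assumes max: "maximal_monotone_op A" and zero: "0 \<in> A z\<^sub>0"
  obtains p x u where "0 \<in> A p"
    and "\<And>z. 0 \<in> A z \<Longrightarrow> (norm (p - v))\<^sup>2 + (norm (p - z))\<^sup>2 \<le> (norm (v - z))\<^sup>2"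
    and "\<And>n. u n \<in> A (x n)" "\<And>n. v - x n = real (Suc n) *\<^sub>R u n" "x \<longlonglongrightarrow> p"
proof -
  note mono = monotone_opD[OF maximal_monotone_op_imp_monotone_op[OF max]]
  define x where "x n = resolvent (real (Suc n)) A v" for n
  have "\<exists>u. u \<in> A (x n) \<and> x n + real (Suc n) *\<^sub>R u = v" for n
    using resolvent_works[OF max, of "real (Suc n)" v] unfolding x_def
    by (metis of_nat_0_less_iff zero_less_Suc)
  then obtain u where u: "u n \<in> A (x n)" and "x n + real (Suc n) *\<^sub>R u n = v" for n
    by metis
  then have xv: "v - x n = real (Suc n) *\<^sub>R u n" for n
    by (metis add_diff_cancel_left')
  have bound: "(norm (x n - v))\<^sup>2 + (norm (x n - z))\<^sup>2 \<le> (norm (v - z))\<^sup>2" if "0 \<in> A z" for n z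
  proof -
    have "inner (v - x n) (x n - z) = real (Suc n) * inner (u n - 0) (x n - z)"
      unfolding xv by simp
    also have "\<dots> \<ge> 0" using mono[OF u that] by simp
    finally show ?thesis
      by (simp add: power2_norm_eq_inner inner_diff inner_commute)
  qed
  \<comment> \<open>Monotonicity makes \<open>inner (v - x n) (x m - x n)\<close> nonpositive: the
    angle at \<open>x n\<close> between \<open>v\<close> and the later point \<open>x m\<close> is
    not acute.\<close>
  have step: "(norm (x n - v))\<^sup>2 + (norm (x m - x n))\<^sup>2 \<le> (norm (x m - v))\<^sup>2" if "n < m" for n m
  proof -
    let ?k = "real (Suc n)" and ?l = "real (Suc m)"
    have d: "x m - x n = ?k *\<^sub>R u n - ?l *\<^sub>R u m"
      using xv[of n] xv[of m] by (metis diff_diff_eq2 diff_add_cancel add_diff_cancel_left' add_diff_eq)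
    have "0 \<le> ?l * inner (u m - u n) (x m - x n)" using mono[OF u u] by simp
    also have "\<dots> = - (norm (x m - x n))\<^sup>2 - (?l - ?k) * inner (u n) (x m - x n)"
      unfolding power2_norm_eq_inner d
      by (simp only: inner_diff inner_scaleR_left inner_scaleR_right)
        (simp add: algebra_simps inner_commute)
    finally have "(?l - ?k) * inner (u n) (x m - x n) \<le> 0"
      using zero_le_power2[of "norm (x m - x n)"] by linarith
    then have "inner (u n) (x m - x n) \<le> 0" using that by (simp add: mult_le_0_iff)
    then have "inner (v - x n) (x m - x n) \<le> 0" unfolding xv by (simp add: mult_le_0_iff)
    then show ?thesis
      by (simp add: power2_norm_eq_inner inner_diff inner_commute)
  qed
  have "incseq (\<lambda>n. (norm (x n - v))\<^sup>2)"
    using step by (intro incseq_SucI) (smt (verit) lessI zero_le_power2)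
  moreover have "(norm (x n - v))\<^sup>2 \<le> (norm (v - z\<^sub>0))\<^sup>2" for n
    using bound[OF zero, of n] zero_le_power2[of "norm (x n - z\<^sub>0)"] by linarith
  ultimately have "Cauchy (\<lambda>n. (norm (x n - v))\<^sup>2)"
    by (intro convergent_Cauchy) (blast intro: incseq_convergent convergentI)
  have "Cauchy x"
  proof (rule metric_CauchyI)
    fix e :: real assume "e > 0"
    then have "e\<^sup>2 > 0" by simp
    then obtain N where N: "\<And>m n. m \<ge> N \<Longrightarrow> n \<ge> N \<Longrightarrow> \<bar>(norm (x m - v))\<^sup>2 - (norm (x n - v))\<^sup>2\<bar> < e\<^sup>2"
      using metric_CauchyD[OF \<open>Cauchy (\<lambda>n. (norm (x n - v))\<^sup>2)\<close>] by (metis dist_real_def)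
    have "(norm (x m - x n))\<^sup>2 \<le> \<bar>(norm (x m - v))\<^sup>2 - (norm (x n - v))\<^sup>2\<bar>" for m n
      using step[of n m] step[of m n] by (cases m n rule: linorder_cases) (auto simp: norm_minus_commute)
    then have "(norm (x m - x n))\<^sup>2 < e\<^sup>2" if "m \<ge> N" "n \<ge> N" for m n
      using N[OF that] le_less_trans by blast
    then have "dist (x m) (x n) < e" if "m \<ge> N" "n \<ge> N" for m n
      using that \<open>e > 0\<close> unfolding dist_norm by (meson power_less_imp_less_base less_imp_le)
    then show "\<exists>M. \<forall>m\<ge>M. \<forall>n\<ge>M. dist (x m) (x n) < e" by blast
  qed
  then obtain p where lim: "x \<longlonglongrightarrow> p" using Cauchy_convergent convergent_def by blast
  have "u n = inverse (real (Suc n)) *\<^sub>R (v - x n)" for n unfolding xv by simp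
  then have "u = (\<lambda>n. inverse (real (Suc n)) *\<^sub>R (v - x n))" by blast
  moreover have "\<dots> \<longlonglongrightarrow> 0 *\<^sub>R (v - p)"
    by (intro tendsto_intros lim LIMSEQ_inverse_real_of_nat)
  ultimately have "u \<longlonglongrightarrow> 0" by simp
  from maximal_monotone_op_closed_graph[OF max u lim this] have "0 \<in> A p" .
  moreover have "(norm (p - v))\<^sup>2 + (norm (p - z))\<^sup>2 \<le> (norm (v - z))\<^sup>2" if "0 \<in> A z" for z
    by (rule LIMSEQ_le_const2[of "\<lambda>n. (norm (x n - v))\<^sup>2 + (norm (x n - z))\<^sup>2"])
      (use bound[OF that] in \<open>auto intro!: tendsto_intros lim\<close>)
  ultimately show thesis using u xv lim by (rule that)
qed

text \<open>The term \<open>(norm (p - z))\<^sup>2\<close> makes \<open>p\<close> not only a closest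
  zero but the only one, so the definite description evaluates to \<open>p\<close>.\<close>

lemma metric_proj_zeros_eqI:
  fixes v :: "'a::real_inner"
  assumes "0 \<in> A p"
    and le: "\<And>z. 0 \<in> A z \<Longrightarrow> (norm (p - v))\<^sup>2 + (norm (p - z))\<^sup>2 \<le> (norm (v - z))\<^sup>2"
  shows "metric_proj (op_inverse A 0) v = p"
  unfolding metric_proj_def op_inverse_def
proof (rule the_equality)
  have "(dist v p)\<^sup>2 \<le> (dist v y)\<^sup>2" if "0 \<in> A y" for y
    using le[OF that] zero_le_power2[of "norm (p - y)"]
    unfolding dist_norm norm_minus_commute[of v p] by linarith
  then have "dist v p \<le> dist v y" if "0 \<in> A y" for y
    using that zero_le_dist power2_le_imp_le by blast
  then show "p \<in> {a. 0 \<in> A a} \<and> (\<forall>y\<in>{a. 0 \<in> A a}. dist v p \<le> dist v y)"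
    using \<open>0 \<in> A p\<close> by blast
  fix q assume q: "q \<in> {a. 0 \<in> A a} \<and> (\<forall>y\<in>{a. 0 \<in> A a}. dist v q \<le> dist v y)"
  then have "(dist v q)\<^sup>2 \<le> (dist v p)\<^sup>2" using \<open>0 \<in> A p\<close> by (intro power_mono) auto
  moreover have "(norm (p - v))\<^sup>2 + (norm (p - q))\<^sup>2 \<le> (norm (v - q))\<^sup>2" using le q by simp
  ultimately have "(norm (p - q))\<^sup>2 \<le> 0"
    unfolding dist_norm norm_minus_commute[of v p] by linarith
  then show "q = p" by simp
qed

text \<open>An approximate zero \<open>y\<close> with residual \<open>s\<close> is compared with a
  path point: monotonicity bounds \<open>inner (v - x n) (y - x n)\<close> by \<open>Suc n\<close>
  times \<open>inner s (y - x n)\<close>. First \<open>n\<close> is fixed with \<open>x n\<close>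
  near \<open>p\<close>, and only then is the residual made small.\<close>

lemma approximate_zeros_variational_ineq:
  fixes A :: "'a::{real_inner, complete_space} \<Rightarrow> 'a set"
  assumes max: "maximal_monotone_op A" and "op_inverse A 0 \<noteq> {}"
    and p_def: "p = metric_proj (op_inverse A 0) v"
  shows "0 \<in> A p"
    and "\<epsilon> > 0 \<Longrightarrow> \<exists>\<eta>>0. \<forall>x. \<forall>u\<in>A x. norm x \<le> M \<longrightarrow> norm u \<le> \<eta> \<longrightarrow> inner (v - p) (x - p) \<le> \<epsilon>"
proof -
  obtain z0 where "0 \<in> A z0" using \<open>op_inverse A 0 \<noteq> {}\<close> by (auto simp: op_inverse_def)
  from resolvent_path_converges[OF max this, of v] obtain q x u where
    "0 \<in> A q" and "\<And>z. 0 \<in> A z \<Longrightarrow> (norm (q - v))\<^sup>2 + (norm (q - z))\<^sup>2 \<le> (norm (v - z))\<^sup>2"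
    and u: "\<And>n. u n \<in> A (x n)" and xv: "\<And>n. v - x n = real (Suc n) *\<^sub>R u n"
    and lim: "x \<longlonglongrightarrow> q" by metis
  then have "q = p" using metric_proj_zeros_eqI[of A q v] by (simp add: p_def)
  then show "0 \<in> A p" using \<open>0 \<in> A q\<close> by simp
  from lim \<open>q = p\<close> have lim: "x \<longlonglongrightarrow> p" by simp
  assume "\<epsilon> > 0"
  obtain B where B: "\<And>n. norm (x n) \<le> B"
    using convergent_imp_Bseq[OF convergentI[OF lim]] by (auto simp: Bseq_def)
  \<comment> \<open>\<open>K\<close> bounds \<open>norm (y - x n) + norm (v - p)\<close>, the factor
    in both error estimates. The \<open>+ 1\<close> makes it positive.\<close>
  define K where "K = \<bar>M\<bar> + \<bar>B\<bar> + norm (v - p) + 1"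
  have K: "K > 0" unfolding K_def by (smt (verit) norm_ge_zero)
  from metric_LIMSEQ_D[OF lim, of "\<epsilon> / (2 * K)"] obtain n where n: "norm (x n - p) < \<epsilon> / (2 * K)"
    using \<open>\<epsilon> > 0\<close> K by (auto simp: dist_norm)
  define \<eta> where "\<eta> = \<epsilon> / (2 * K * real (Suc n))"
  have "\<eta> > 0" using \<open>\<epsilon> > 0\<close> K by (simp add: \<eta>_def)
  moreover have "inner (v - p) (y - p) \<le> \<epsilon>" if s: "s \<in> A y" "norm y \<le> M" "norm s \<le> \<eta>" for y s
  proof -
    have yx: "norm (y - x n) + norm (v - p) \<le> K"
      using norm_triangle_ineq4[of y "x n"] s B[of n] unfolding K_def by linarith
    have "0 \<le> real (Suc n) * inner (s - u n) (y - x n)"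
      using monotone_opD[OF maximal_monotone_op_imp_monotone_op[OF max] s(1) u] by simp
    then have "inner (v - x n) (y - x n) \<le> real (Suc n) * inner s (y - x n)"
      unfolding xv by (simp add: inner_diff_left right_diff_distrib)
    also have "\<dots> \<le> real (Suc n) * (\<eta> * K)"
    proof (rule mult_left_mono)
      have "inner s (y - x n) \<le> norm s * norm (y - x n)" by (rule norm_cauchy_schwarz)
      also have "\<dots> \<le> \<eta> * K"
      proof (rule mult_mono)
        show "norm (y - x n) \<le> K" using yx by (smt (verit) norm_ge_zero)
      qed (use s \<open>\<eta> > 0\<close> in auto)
      finally show "inner s (y - x n) \<le> \<eta> * K" .
    qed simp
    also have "\<dots> = \<epsilon> / 2" using K by (simp add: \<eta>_def del: of_nat_Suc)
    finally have 1: "inner (v - x n) (y - x n) \<le> \<epsilon> / 2" .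
    have "inner (x n - p) (y - x n) + inner (v - p) (x n - p)
        \<le> norm (x n - p) * (norm (y - x n) + norm (v - p))"
      using norm_cauchy_schwarz[of "x n - p" "y - x n"] norm_cauchy_schwarz[of "v - p" "x n - p"]
      by (simp add: algebra_simps)
    also have "\<dots> \<le> \<epsilon> / (2 * K) * K"
      using n yx K \<open>\<epsilon> > 0\<close> by (intro mult_mono) auto
    also have "\<dots> = \<epsilon> / 2" using K by simp
    finally have 2: "inner (x n - p) (y - x n) + inner (v - p) (x n - p) \<le> \<epsilon> / 2" .
    have "inner (v - p) (y - p)
      = inner (v - x n) (y - x n) + (inner (x n - p) (y - x n) + inner (v - p) (x n - p))"
      by (simp add: inner_diff inner_commute)
    with 1 2 show ?thesis by simp
  qed
  ultimately show "\<exists>\<eta>>0. \<forall>x. \<forall>u\<in>A x. norm x \<le> M \<longrightarrow> norm u \<le> \<eta> \<longrightarrow> inner (v - p) (x - p) \<le> \<epsilon>"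
    by blast
qed

section \<open>Halpern-type recursions\<close>

text \<open>Subtracting the partial sums of \<open>c\<close> turns \<open>f\<close> into a
  decreasing sequence that is still bounded below.\<close>

lemma almost_decreasing_convergent:
  fixes f c :: "nat \<Rightarrow> real"
  assumes step: "\<And>n. f (Suc n) \<le> f n + c n" and c: "\<And>n. c n \<ge> 0" "summable c"
    and lower: "\<And>n. m \<le> f n"
  shows "convergent f"
proof -
  let ?g = "\<lambda>n. f n - (\<Sum>i<n. c i)"
  have "decseq ?g" using step by (intro decseq_SucI) (simp add: algebra_simps)
  moreover have "m - suminf c \<le> ?g n" for n
    using lower[of n] sum_le_suminf[OF c(2), of "{..<n}"] c(1) by fastforce
  ultimately have "convergent ?g"
    using decseq_convergent[of ?g "m - suminf c"] unfolding convergent_def by blast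
  moreover have "convergent (\<lambda>n. \<Sum>i<n. c i)" using c(2) by (simp add: summable_iff_convergent)
  ultimately have "convergent (\<lambda>n. ?g n + (\<Sum>i<n. c i))" by (rule convergent_add)
  then show ?thesis by simp
qed

text \<open>While \<open>a n\<close> is at least \<open>2 * \<epsilon>\<close>, each step lowers it
  by at least \<open>\<sigma> n * \<epsilon>\<close>, which cannot go on because the sum diverges.
  Once below \<open>2 * \<epsilon>\<close>, it stays there.\<close>

lemma halpern_recursion_tendsto_zero:
  fixes a \<sigma> :: "nat \<Rightarrow> real"
  assumes nonneg: "\<forall>\<^sub>F n in sequentially. a n \<ge> 0"
    and \<sigma>: "\<And>n. 0 \<le> \<sigma> n" "\<And>n. \<sigma> n \<le> 1"
    and div: "filterlim (\<lambda>n. \<Sum>i<n. \<sigma> i) at_top sequentially"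
    and rec: "\<And>\<epsilon>. \<epsilon> > 0 \<Longrightarrow> \<forall>\<^sub>F n in sequentially. a (Suc n) \<le> (1 - \<sigma> n) * a n + \<sigma> n * \<epsilon>"
  shows "a \<longlonglongrightarrow> 0"
proof -
  have ev: "\<forall>\<^sub>F n in sequentially. a n < 2 * \<epsilon>" if "\<epsilon> > 0" for \<epsilon>
  proof -
    obtain N where N: "\<And>n. n \<ge> N \<Longrightarrow> a (Suc n) \<le> (1 - \<sigma> n) * a n + \<sigma> n * \<epsilon>"
      using rec[OF \<open>\<epsilon> > 0\<close>] by (auto simp: eventually_sequentially)
    have "\<exists>n\<ge>N. a n < 2 * \<epsilon>"
    proof (rule ccontr)
      assume "\<not> ?thesis"
      then have big: "a n \<ge> 2 * \<epsilon>" if "n \<ge> N" for n using that by force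
      have "a n + \<epsilon> * (\<Sum>i<n. \<sigma> i) \<le> a N + \<epsilon> * (\<Sum>i<N. \<sigma> i)" if "n \<ge> N" for n
        using that
      proof (induction rule: dec_induct)
        case (step n)
        have "\<sigma> n * \<epsilon> \<le> \<sigma> n * (a n - \<epsilon>)"
          using big[of n] step \<sigma>(1) by (intro mult_left_mono) auto
        then show ?case using N[of n] step by (simp add: algebra_simps)
      qed simp
      then have "(\<Sum>i<n. \<sigma> i) \<le> (a N + \<epsilon> * (\<Sum>i<N. \<sigma> i)) / \<epsilon>" if "n \<ge> N" for n
        using that big[OF that] \<open>\<epsilon> > 0\<close> by (fastforce simp: pos_le_divide_eq mult.commute)
      moreover have "\<forall>\<^sub>F n in sequentially. (\<Sum>i<n. \<sigma> i) > (a N + \<epsilon> * (\<Sum>i<N. \<sigma> i)) / \<epsilon>"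
        using div by (simp add: filterlim_at_top_dense)
      ultimately show False
        by (metis (no_types, lifting) eventually_sequentially linorder_not_le nle_le)
    qed
    then obtain M where M: "M \<ge> N" "a M < 2 * \<epsilon>" by blast
    have "a n < 2 * \<epsilon>" if "n \<ge> M" for n
      using that
    proof (induction rule: dec_induct)
      case (step n)
      have "(1 - \<sigma> n) * a n \<le> (1 - \<sigma> n) * (2 * \<epsilon>)"
        using step \<sigma>(2)[of n] by (intro mult_left_mono) auto
      \<comment> \<open>The bound stays strict: either the drop
        \<open>\<sigma> n * \<epsilon>\<close> is positive, or the recursion reads
        \<open>a (Suc n) \<le> a n\<close>.\<close>
      moreover have "\<sigma> n * \<epsilon> > 0 \<or> \<sigma> n = 0" using \<sigma>(1)[of n] \<open>\<epsilon> > 0\<close> by (simp add: less_le)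
      ultimately show ?case
        using N[of n] step M by (auto simp: algebra_simps)
    qed (rule M)
    then show ?thesis by (auto simp: eventually_sequentially)
  qed
  show ?thesis
  proof (rule tendstoI)
    fix e :: real assume "e > 0"
    then have "\<forall>\<^sub>F n in sequentially. a n < 2 * (e / 2)" by (intro ev) simp
    with nonneg show "\<forall>\<^sub>F n in sequentially. dist (a n) 0 < e"
      by eventually_elim simp
  qed
qed

text \<open>Polarization of the inner product in \<open>mono\<close>. Splitting
  \<open>w' - z\<close> into \<open>w - z\<close> and \<open>w' - w\<close> reproduces the old
  correction term and leaves a cross term with \<open>y\<close>, handled by Young's inequality;
  \<open>D\<close> stands for the length of the previous increment.\<close>

lemma halpern_inertial_step:
  fixes w w' v z y y' :: "'a::real_inner"
  assumes mono: "0 \<le> inner (\<sigma> *\<^sub>R v + (1 - \<sigma>) *\<^sub>R w - w' + y' - (1 - \<sigma>) *\<^sub>R y) (w' - z)"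
    and y: "norm y \<le> \<rho> * D" and \<rho>: "\<rho> \<ge> 0" and \<sigma>: "\<sigma> \<le> 1"
  shows "(norm (w' - z))\<^sup>2 - 2 * inner y' (w' - z) + \<sigma> * (norm (w' - z))\<^sup>2
    \<le> (1 - \<sigma>) * ((norm (w - z))\<^sup>2 - 2 * inner y (w - z) + \<rho> * D\<^sup>2 + \<rho> * (norm (w' - w))\<^sup>2 - (norm (w' - w))\<^sup>2)
      + 2 * \<sigma> * inner (v - z) (w' - z)"
proof -
  have id: "2 * inner (\<sigma> *\<^sub>R v + (1 - \<sigma>) *\<^sub>R w - w' + y' - (1 - \<sigma>) *\<^sub>R y) (w' - z)
    = (1 - \<sigma>) * ((norm (w - z))\<^sup>2 - 2 * inner y (w - z) - 2 * inner y (w' - w) - (norm (w' - w))\<^sup>2)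
      + 2 * \<sigma> * inner (v - z) (w' - z) - (norm (w' - z))\<^sup>2 - \<sigma> * (norm (w' - z))\<^sup>2 + 2 * inner y' (w' - z)"
    unfolding power2_norm_eq_inner
    by (simp add: inner_diff inner_add inner_commute algebra_simps)
  let ?d = "norm (w' - w)"
  have "- 2 * inner y (w' - w) \<le> 2 * (norm y * ?d)"
    using Cauchy_Schwarz_ineq2[of y "w' - w"] by linarith
  also have "\<dots> \<le> 2 * (\<rho> * D * ?d)"
    using y by (intro mult_left_mono mult_right_mono) auto
  also have "\<dots> = \<rho> * (2 * D * ?d)" by simp
  also have "\<dots> \<le> \<rho> * (D\<^sup>2 + ?d\<^sup>2)" by (intro mult_left_mono sum_squares_bound \<rho>)
  finally have "(1 - \<sigma>) * (- 2 * inner y (w' - w)) \<le> (1 - \<sigma>) * (\<rho> * (D\<^sup>2 + ?d\<^sup>2))"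
    using \<sigma> by (intro mult_left_mono) auto
  with mono id show ?thesis by (simp add: algebra_simps)
qed

text \<open>Separates the convergence argument from the step-size rule: the algorithm enters only
  through an inclusion for the sum operator and a bound on the correction \<open>y\<close>, both
  holding eventually.\<close>

lemma halpern_inertial_convergence:
  fixes A :: "'a::{real_inner, complete_space} \<Rightarrow> 'a set"
    and w y :: "nat \<Rightarrow> 'a" and \<sigma> \<delta> :: "nat \<Rightarrow> real"
  assumes max: "maximal_monotone_op A" and ne: "op_inverse A 0 \<noteq> {}"
    and \<sigma>: "\<And>n. n \<ge> 1 \<Longrightarrow> \<sigma> n \<in> {0<..<1}" "\<sigma> \<longlonglongrightarrow> 0"
      "filterlim (\<lambda>N. \<Sum>n=1..N. \<sigma> n) at_top sequentially"
    and \<delta>: "\<forall>\<^sub>F n in sequentially. l \<le> \<delta> n" "l > 0"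
    and step: "\<forall>\<^sub>F n in sequentially. \<exists>u\<in>A (w (Suc n)).
      \<delta> n *\<^sub>R u = \<sigma> n *\<^sub>R v + (1 - \<sigma> n) *\<^sub>R w n - w (Suc n) + y (Suc n) - (1 - \<sigma> n) *\<^sub>R y n"
    and y: "\<forall>\<^sub>F n in sequentially. norm (y (Suc n)) \<le> \<rho> * norm (w (Suc n) - w n)"
    and \<rho>: "0 \<le> \<rho>" "\<rho> < 1/2"
  shows "w \<longlonglongrightarrow> metric_proj (op_inverse A 0) v"
proof -
  define p where "p = metric_proj (op_inverse A 0) v"
  note p = approximate_zeros_variational_ineq[OF max ne p_def]
  \<comment> \<open>A quarter of the gap \<open>1/2 - \<rho>\<close>. The weight
    \<open>\<rho> + 2 * \<kappa>\<close> in \<open>a\<close> lies midway between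
    \<open>\<rho>\<close> and 1/2.\<close>
  define \<kappa> where "\<kappa> = 1/8 - \<rho> / 4"
  have \<kappa>: "\<kappa> > 0" "\<kappa> \<le> 1/8" "\<rho> = 1/2 - 4 * \<kappa>" using \<rho> by (auto simp: \<kappa>_def)
  \<comment> \<open>Indices are shifted by one: \<open>e n\<close> and \<open>a n\<close> belong to
    the iterate \<open>w (Suc n)\<close>, and \<open>d n\<close> is the length of the increment
    leading to it.\<close>
  define d where "d n = norm (w (Suc n) - w n)" for n
  define e where "e n = w (Suc n) - p" for n
  define a where "a n = (norm (e n))\<^sup>2 - 2 * inner (y (Suc n)) (e n) + (\<rho> + 2 * \<kappa>) * (d n)\<^sup>2" for n
  let ?s = "\<lambda>n. \<sigma> (Suc n)"
  have s: "0 < ?s n" "?s n < 1" for n using \<sigma>(1)[of "Suc n"] by auto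
  have s_lim: "?s \<longlonglongrightarrow> 0" using \<sigma>(2) by (rule LIMSEQ_Suc)
  have s_small: "\<forall>\<^sub>F n in sequentially. ?s n * C \<le> b" if "b > 0" for C b
  proof -
    have "(\<lambda>n. ?s n * C) \<longlonglongrightarrow> 0" using tendsto_mult_left_zero[OF s_lim] .
    from order_tendstoD(2)[OF this that] show ?thesis by eventually_elim simp
  qed
  have "\<forall>\<^sub>F n in sequentially. ?s n \<le> \<kappa>" using s_small[OF \<kappa>(1), of 1] by simp
  moreover have "\<forall>\<^sub>F n in sequentially. norm (y (Suc n)) \<le> \<rho> * d n"
    using y by (simp add: d_def)
  moreover from this have "\<forall>\<^sub>F n in sequentially. norm (y (Suc (Suc n))) \<le> \<rho> * d (Suc n)"
    by (subst (asm) eventually_sequentially_Suc[symmetric])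
  moreover have "\<forall>\<^sub>F n in sequentially. l \<le> \<delta> (Suc n)"
    using \<delta>(1) by (subst (asm) eventually_sequentially_Suc[symmetric])
  moreover have "\<forall>\<^sub>F n in sequentially. \<exists>u\<in>A (w (Suc (Suc n))). \<delta> (Suc n) *\<^sub>R u =
      ?s n *\<^sub>R v + (1 - ?s n) *\<^sub>R w (Suc n) - w (Suc (Suc n)) + y (Suc (Suc n)) - (1 - ?s n) *\<^sub>R y (Suc n)"
    using step by (subst (asm) eventually_sequentially_Suc[symmetric])
  ultimately have "\<forall>\<^sub>F n in sequentially. ?s n \<le> \<kappa> \<and> norm (y (Suc n)) \<le> \<rho> * d n \<and>
      norm (y (Suc (Suc n))) \<le> \<rho> * d (Suc n) \<and> l \<le> \<delta> (Suc n) \<and>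
      (\<exists>u\<in>A (w (Suc (Suc n))). \<delta> (Suc n) *\<^sub>R u =
      ?s n *\<^sub>R v + (1 - ?s n) *\<^sub>R w (Suc n) - w (Suc (Suc n)) + y (Suc (Suc n)) - (1 - ?s n) *\<^sub>R y (Suc n))"
    by eventually_elim blast
  then obtain N where s\<kappa>: "\<And>n. n \<ge> N \<Longrightarrow> ?s n \<le> \<kappa>"
    and y1: "\<And>n. n \<ge> N \<Longrightarrow> norm (y (Suc n)) \<le> \<rho> * d n"
    and y2: "\<And>n. n \<ge> N \<Longrightarrow> norm (y (Suc (Suc n))) \<le> \<rho> * d (Suc n)"
    and l\<delta>: "\<And>n. n \<ge> N \<Longrightarrow> l \<le> \<delta> (Suc n)"
    and incl: "\<And>n. n \<ge> N \<Longrightarrow> \<exists>u\<in>A (w (Suc (Suc n))). \<delta> (Suc n) *\<^sub>R u =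
      ?s n *\<^sub>R v + (1 - ?s n) *\<^sub>R w (Suc n) - w (Suc (Suc n)) + y (Suc (Suc n)) - (1 - ?s n) *\<^sub>R y (Suc n)"
    unfolding eventually_sequentially by blast
  have a_lower: "(norm (e n))\<^sup>2 \<le> 2 * a n" if "n \<ge> N" for n
  proof -
    have "2 * inner (y (Suc n)) (e n) \<le> 2 * (norm (y (Suc n)) * norm (e n))"
      using norm_cauchy_schwarz by simp
    also have "\<dots> \<le> 2 * (\<rho> * d n * norm (e n))"
      using y1[OF that] by (intro mult_left_mono mult_right_mono) auto
    also have "\<dots> = \<rho> * (2 * d n * norm (e n))" by simp
    also have "\<dots> \<le> \<rho> * ((d n)\<^sup>2 + (norm (e n))\<^sup>2)" by (intro mult_left_mono sum_squares_bound \<rho>(1))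
    finally have "a n \<ge> (1 - \<rho>) * (norm (e n))\<^sup>2 + 2 * \<kappa> * (d n)\<^sup>2"
      unfolding a_def by (simp add: algebra_simps)
    moreover have "(1 - \<rho>) * (norm (e n))\<^sup>2 \<ge> 1/2 * (norm (e n))\<^sup>2"
      using \<rho> by (intro mult_right_mono) auto
    moreover have "2 * \<kappa> * (d n)\<^sup>2 \<ge> 0" using \<kappa>(1) by simp
    ultimately show ?thesis by linarith
  qed
  have a_step: "a (Suc n) \<le> (1 - ?s n) * a n - \<kappa> * ((d n)\<^sup>2 + (d (Suc n))\<^sup>2)
      + 2 * ?s n * inner (v - p) (e (Suc n)) - ?s n * (norm (e (Suc n)))\<^sup>2" if n: "n \<ge> N" for n
  proof -
    obtain u where u: "u \<in> A (w (Suc (Suc n)))" and eq: "\<delta> (Suc n) *\<^sub>R u =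
      ?s n *\<^sub>R v + (1 - ?s n) *\<^sub>R w (Suc n) - w (Suc (Suc n)) + y (Suc (Suc n)) - (1 - ?s n) *\<^sub>R y (Suc n)"
      using incl[OF n] by blast
    have "0 \<le> \<delta> (Suc n) * inner (u - 0) (w (Suc (Suc n)) - p)"
      using monotone_opD[OF maximal_monotone_op_imp_monotone_op[OF max] u p(1)] l\<delta>[OF n] \<open>l > 0\<close>
      by simp
    then have "0 \<le> inner (?s n *\<^sub>R v + (1 - ?s n) *\<^sub>R w (Suc n) - w (Suc (Suc n)) + y (Suc (Suc n))
        - (1 - ?s n) *\<^sub>R y (Suc n)) (w (Suc (Suc n)) - p)"
      unfolding eq[symmetric] by simp
    from halpern_inertial_step[OF this y1[OF n] \<rho>(1)] s[of n]
    have *: "(norm (e (Suc n)))\<^sup>2 - 2 * inner (y (Suc (Suc n))) (e (Suc n)) + ?s n * (norm (e (Suc n)))\<^sup>2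
      \<le> (1 - ?s n) * ((norm (e n))\<^sup>2 - 2 * inner (y (Suc n)) (e n) + \<rho> * (d n)\<^sup>2 + \<rho> * (d (Suc n))\<^sup>2 - (d (Suc n))\<^sup>2)
      + 2 * ?s n * inner (v - p) (e (Suc n))"
      by (simp add: e_def d_def)
    \<comment> \<open>As \<open>1 - \<sigma> (Suc n)\<close> is at least 1/2, the surplus
      \<open>2 * \<kappa>\<close> in the weight of \<open>d n\<close> yields a decrease of
      \<open>\<kappa>\<close>. The next inequality pays for the weight of \<open>d (Suc n)\<close>
      in \<open>a (Suc n)\<close> and leaves another \<open>\<kappa>\<close>.\<close>
    have "\<kappa> * (d n)\<^sup>2 \<le> ((1 - ?s n) * (2 * \<kappa>)) * (d n)\<^sup>2"
      using s\<kappa>[OF n] \<kappa> by (intro mult_right_mono) auto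
    moreover have "(\<rho> + 2 * \<kappa> + \<kappa>) * (d (Suc n))\<^sup>2 \<le> ((1 - ?s n) * (1 - \<rho>)) * (d (Suc n))\<^sup>2"
    proof (rule mult_right_mono)
      have "(1 - \<kappa>) * (1 - \<rho>) \<le> (1 - ?s n) * (1 - \<rho>)"
        using s\<kappa>[OF n] \<rho> by (intro mult_right_mono) auto
      moreover have "\<kappa> * (1 - \<rho>) \<le> \<kappa> * 1" using \<kappa>(1) \<rho>(1) by (intro mult_left_mono) auto
      moreover have "(1 - \<kappa>) * (1 - \<rho>) = 1 - \<rho> - \<kappa> * (1 - \<rho>)" by (simp add: algebra_simps)
      ultimately show "\<rho> + 2 * \<kappa> + \<kappa> \<le> (1 - ?s n) * (1 - \<rho>)" using \<kappa> by linarith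
    qed simp
    ultimately show ?thesis using * unfolding a_def by (simp add: algebra_simps)
  qed
  \<comment> \<open>Completing the square bounds the anchor terms by
    \<open>(norm (v - p))\<^sup>2\<close>, so \<open>a (Suc n)\<close> is at most a convex
    combination of \<open>a n\<close> and this constant.\<close>
  define K where "K = max (a N) ((norm (v - p))\<^sup>2)"
  have a_bdd: "a n \<le> K" if "n \<ge> N" for n
    using that
  proof (induction rule: dec_induct)
    case (step n)
    have "2 * inner (v - p) (e (Suc n)) - (norm (e (Suc n)))\<^sup>2 \<le> (norm (v - p))\<^sup>2"
      using zero_le_power2[of "norm (v - p - e (Suc n))"]
      unfolding power2_norm_eq_inner by (simp add: inner_diff inner_commute)
    also have "\<dots> \<le> K" by (simp add: K_def)
    finally have "?s n * (2 * inner (v - p) (e (Suc n)) - (norm (e (Suc n)))\<^sup>2) \<le> ?s n * K"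
      using s[of n] by (intro mult_left_mono) auto
    moreover have "(1 - ?s n) * a n \<le> (1 - ?s n) * K"
      using s[of n] step by (intro mult_left_mono) auto
    moreover have "\<kappa> * ((d n)\<^sup>2 + (d (Suc n))\<^sup>2) \<ge> 0" using \<kappa>(1) by simp
    ultimately show ?case using a_step[OF step(1)] by (simp add: algebra_simps)
  qed (simp add: K_def)
  define E where "E = sqrt (2 * K)"
  have e_bdd: "norm (e n) \<le> E" if "n \<ge> N" for n
    unfolding E_def using a_lower[OF that] a_bdd[OF that] by (intro real_le_rsqrt) auto
  define M where "M = E + norm p"
  have w_bdd: "norm (w (Suc n)) \<le> M" if "n \<ge> N" for n
    using e_bdd[OF that] norm_triangle_ineq[of "w (Suc n) - p" p] by (simp add: e_def M_def)
  have rec: "\<forall>\<^sub>F n in sequentially. a (Suc n) \<le> (1 - ?s n) * a n + ?s n * \<epsilon>" if "\<epsilon> > 0" for \<epsilon>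
  proof -
    obtain \<eta> where \<eta>: "\<eta> > 0" and
      approx: "\<And>x u. u \<in> A x \<Longrightarrow> norm x \<le> M \<Longrightarrow> norm u \<le> \<eta> \<Longrightarrow> inner (v - p) (x - p) \<le> \<epsilon> / 2"
      using p(2)[of "\<epsilon> / 2" M] \<open>\<epsilon> > 0\<close> by auto
    \<comment> \<open>The residual is estimated by \<open>6 * \<theta>\<close>: three for the anchor
      term, one for the increment and one for each of the two corrections.\<close>
    define \<theta> where "\<theta> = l * \<eta> / 6"
    have \<theta>: "\<theta> > 0" using \<eta> \<open>l > 0\<close> by (simp add: \<theta>_def)
    have "\<forall>\<^sub>F n in sequentially. ?s n * (norm v + M) \<le> 3 * \<theta>"
      "\<forall>\<^sub>F n in sequentially. ?s n * (2 * norm (v - p) * E) \<le> \<kappa> * \<theta>\<^sup>2"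
      using \<theta> \<kappa>(1) by (auto intro!: s_small)
    then show ?thesis using eventually_ge_at_top[of N]
    proof eventually_elim
      case (elim n)
      note n = \<open>N \<le> n\<close>
      show ?case
      proof (cases "d n \<le> \<theta> \<and> d (Suc n) \<le> \<theta>")
        case True
        obtain u where u: "u \<in> A (w (Suc (Suc n)))" and eq: "\<delta> (Suc n) *\<^sub>R u =
          ?s n *\<^sub>R v + (1 - ?s n) *\<^sub>R w (Suc n) - w (Suc (Suc n)) + y (Suc (Suc n)) - (1 - ?s n) *\<^sub>R y (Suc n)"
          using incl[OF n] by blast
        have "\<rho> * d (Suc n) \<le> 1 * \<theta>" "\<rho> * d n \<le> 1 * \<theta>"
          using True \<rho> by (intro mult_mono; simp add: d_def)+
        then have y_le: "norm (y (Suc (Suc n))) \<le> \<theta>" "norm (y (Suc n)) \<le> \<theta>"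
          using y1[OF n] y2[OF n] by auto
        have "l * norm u \<le> norm (\<delta> (Suc n) *\<^sub>R u)"
          using l\<delta>[OF n] \<open>l > 0\<close> by (auto intro!: mult_right_mono)
        also have "\<delta> (Suc n) *\<^sub>R u = ?s n *\<^sub>R (v - w (Suc n)) + (w (Suc n) - w (Suc (Suc n)))
            + (y (Suc (Suc n)) - (1 - ?s n) *\<^sub>R y (Suc n))"
          unfolding eq by (simp add: algebra_simps)
        also have "norm \<dots> \<le> norm (?s n *\<^sub>R (v - w (Suc n))) + norm (w (Suc n) - w (Suc (Suc n)))
            + (norm (y (Suc (Suc n))) + norm ((1 - ?s n) *\<^sub>R y (Suc n)))"
          by (intro norm_triangle_mono norm_triangle_ineq4 order_refl)
        also have "\<dots> \<le> 3 * \<theta> + \<theta> + (\<theta> + \<theta>)"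
        proof (intro add_mono)
          have "norm (v - w (Suc n)) \<le> norm v + M"
            using norm_triangle_ineq4[of v "w (Suc n)"] w_bdd[OF n] by linarith
          then have "?s n * norm (v - w (Suc n)) \<le> ?s n * (norm v + M)"
            using s[of n] by (intro mult_left_mono) auto
          then have "?s n * norm (v - w (Suc n)) \<le> 3 * \<theta>" using elim(1) by linarith
          then show "norm (?s n *\<^sub>R (v - w (Suc n))) \<le> 3 * \<theta>" using s[of n] by simp
          show "norm (w (Suc n) - w (Suc (Suc n))) \<le> \<theta>"
            using True by (simp add: d_def norm_minus_commute)
          have "(1 - ?s n) * norm (y (Suc n)) \<le> 1 * \<theta>"
            using s[of n] y_le by (intro mult_mono) auto
          then show "norm ((1 - ?s n) *\<^sub>R y (Suc n)) \<le> \<theta>" using s[of n] by simp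
        qed (rule y_le)
        also have "\<dots> = l * \<eta>" by (simp add: \<theta>_def)
        finally have "norm u \<le> \<eta>" using \<open>l > 0\<close> by simp
        from approx[OF u w_bdd this] n have "2 * inner (v - p) (e (Suc n)) \<le> \<epsilon>" by (simp add: e_def)
        then have "?s n * (2 * inner (v - p) (e (Suc n))) \<le> ?s n * \<epsilon>"
          using s[of n] by (intro mult_left_mono) auto
        moreover have "\<kappa> * ((d n)\<^sup>2 + (d (Suc n))\<^sup>2) \<ge> 0" "?s n * (norm (e (Suc n)))\<^sup>2 \<ge> 0"
          using \<kappa>(1) s[of n] by auto
        ultimately show ?thesis using a_step[OF n] by simp
      next
        case False
        then have "\<theta>\<^sup>2 \<le> (d n)\<^sup>2 \<or> \<theta>\<^sup>2 \<le> (d (Suc n))\<^sup>2"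
          using \<theta> by (auto intro!: power_mono)
        then have "\<theta>\<^sup>2 \<le> (d n)\<^sup>2 + (d (Suc n))\<^sup>2"
          using zero_le_power2[of "d n"] zero_le_power2[of "d (Suc n)"] by linarith
        then have "\<kappa> * \<theta>\<^sup>2 \<le> \<kappa> * ((d n)\<^sup>2 + (d (Suc n))\<^sup>2)"
          using \<kappa>(1) by (intro mult_left_mono) auto
        moreover have "inner (v - p) (e (Suc n)) \<le> norm (v - p) * E"
          using norm_cauchy_schwarz[of "v - p" "e (Suc n)"] mult_left_mono[OF e_bdd[of "Suc n"], of "norm (v - p)"] n
          by auto
        then have "2 * ?s n * inner (v - p) (e (Suc n)) \<le> ?s n * (2 * norm (v - p) * E)"
          using s[of n] by simp
        moreover have "?s n * (norm (e (Suc n)))\<^sup>2 \<ge> 0" "?s n * \<epsilon> \<ge> 0"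
          using s[of n] \<open>\<epsilon> > 0\<close> by auto
        ultimately show ?thesis using a_step[OF n] elim(2) by linarith
      qed
    qed
  qed
  have "a \<longlonglongrightarrow> 0"
  proof (rule halpern_recursion_tendsto_zero[where \<sigma> = ?s])
    have "a n \<ge> 0" if "n \<ge> N" for n
      using a_lower[OF that] zero_le_power2[of "norm (e n)"] by linarith
    then show "\<forall>\<^sub>F n in sequentially. a n \<ge> 0" by (auto simp: eventually_sequentially)
    show "filterlim (\<lambda>n. \<Sum>i<n. ?s i) at_top sequentially"
      using \<sigma>(3) by (simp add: sum.atLeast1_atMost_eq)
  qed (use s rec in \<open>auto simp: less_imp_le\<close>)
  then have "(\<lambda>n. 2 * a n) \<longlonglongrightarrow> 0" by (rule tendsto_mult_right_zero)
  moreover have "\<forall>\<^sub>F n in sequentially. norm ((norm (e n))\<^sup>2) \<le> 2 * a n"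
    using a_lower by (auto simp: eventually_sequentially)
  ultimately have "(\<lambda>n. (norm (e n))\<^sup>2) \<longlonglongrightarrow> 0" by (rule Lim_null_comparison[rotated])
  then have "(\<lambda>n. sqrt ((norm (e n))\<^sup>2)) \<longlonglongrightarrow> sqrt 0" by (rule tendsto_real_sqrt)
  then have "e \<longlonglongrightarrow> 0" by (simp add: tendsto_norm_zero_iff)
  then have "(\<lambda>n. w (Suc n)) \<longlonglongrightarrow> p" unfolding e_def by (simp add: LIM_zero_iff)
  then show ?thesis unfolding p_def by (rule LIMSEQ_imp_Suc)
qed

section \<open>The adaptive forward-reflected-backward method\<close>

text \<open>The Lipschitz bound keeps the quotient in the rule above \<open>r / L\<close>, so the
  step sizes never fall below \<open>min (r / L) (\<delta> 1)\<close>. They increase by at most the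
  summable \<open>c n\<close>, hence converge.\<close>

lemma adaptive_stepsize_limit:
  fixes T :: "'a::real_normed_vector \<Rightarrow> 'a" and \<delta> c :: "nat \<Rightarrow> real" and w :: "nat \<Rightarrow> 'a"
  assumes lip: "L-lipschitz_on UNIV T" and L: "L > 0" and r: "r > 0" and \<delta>1: "\<delta> 1 > 0"
    and c: "\<forall>n\<ge>1. c n \<ge> 0" "summable (\<lambda>n. c (Suc n))"
    and rec: "\<forall>n\<ge>1. \<delta> (n + 1) =
           (if T (w n) \<noteq> T (w (n + 1))
            then min (r * norm (w n - w (n + 1)) / norm (T (w n) - T (w (n + 1)))) (\<delta> n + c n)
            else \<delta> n + c n)"
  obtains l where "l > 0" "\<delta> \<longlonglongrightarrow> l"
proof -
  define m where "m = min (r / L) (\<delta> 1)"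
  have m: "m > 0" using L r \<delta>1 by (simp add: m_def)
  have lower: "m \<le> \<delta> (Suc n)" for n
  proof (induction n)
    case (Suc n)
    let ?d = "norm (w (Suc n) - w (Suc (Suc n)))"
    let ?D = "norm (T (w (Suc n)) - T (w (Suc (Suc n))))"
    have "r / L \<le> r * ?d / ?D" if "T (w (Suc n)) \<noteq> T (w (Suc (Suc n)))"
    proof -
      have "r * ?D \<le> r * (L * ?d)"
        using lipschitz_onD[OF lip, of "w (Suc n)" "w (Suc (Suc n))"] r
        by (intro mult_left_mono) (auto simp: dist_norm)
      then show ?thesis using L that by (simp add: field_simps)
    qed
    moreover have "m \<le> r / L" by (simp add: m_def)
    moreover have "m \<le> \<delta> (Suc n) + c (Suc n)" using Suc c(1) by (simp add: add_increasing2)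
    ultimately show ?case using rec[rule_format, of "Suc n"] by auto
  qed (simp add: m_def)
  have "convergent (\<lambda>n. \<delta> (Suc n))"
  proof (rule almost_decreasing_convergent[where c = "\<lambda>n. c (Suc n)"])
    show "\<delta> (Suc (Suc n)) \<le> \<delta> (Suc n) + c (Suc n)" for n
      using rec[rule_format, of "Suc n"] by simp
  qed (use c lower in auto)
  then obtain l where l: "(\<lambda>n. \<delta> (Suc n)) \<longlonglongrightarrow> l" by (auto simp: convergent_def)
  with lower have "m \<le> l" by (intro LIMSEQ_le_const) auto
  with m l show thesis by (intro that[of l]) (auto intro: LIMSEQ_imp_Suc)
qed

theorem theorem3p5:
  fixes S :: "'a::{real_inner, complete_space} \<Rightarrow> 'a set"
    and T :: "'a \<Rightarrow> 'a"
    and L \<beta> r :: real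
    and \<sigma> c \<delta> :: "nat \<Rightarrow> real"
    and v :: 'a
    and w :: "nat \<Rightarrow> 'a"
  assumes "maximal_monotone_op S"
    and "\<forall>a b. inner (T a - T b) (a - b) \<ge> 0"
    and "L > 0" and "L-lipschitz_on UNIV T"
    and "op_inverse (\<lambda>x. S x + {T x}) 0 \<noteq> {}"
    and "\<delta> 0 > 0" and "\<delta> 1 > 0"
    and "\<beta> \<in> {0<..<1/4}"
    and "r \<in> {\<beta><..<(1 - 2 * \<beta>) / 2}"
    and "\<forall>n\<ge>1. \<sigma> n \<in> {0<..<1}"
    and "\<forall>n\<ge>1. c n \<ge> 0" and "summable (\<lambda>n. c (Suc n))"
    and "\<forall>n\<ge>1. w (n + 1) = resolvent (\<delta> n) S
           (\<sigma> n *\<^sub>R v + (1 - \<sigma> n) *\<^sub>R w n - \<delta> n *\<^sub>R T (w n)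
             - (\<delta> (n - 1) * (1 - \<sigma> n)) *\<^sub>R (T (w n) - T (w (n - 1))))"
    and "\<forall>n\<ge>1. \<delta> (n + 1) =
           (if T (w n) \<noteq> T (w (n + 1))
            then min (r * norm (w n - w (n + 1)) / norm (T (w n) - T (w (n + 1)))) (\<delta> n + c n)
            else \<delta> n + c n)"
    and "\<sigma> \<longlonglongrightarrow> 0"
    and "filterlim (\<lambda>N. \<Sum>n=1..N. \<sigma> n) at_top sequentially"
  shows "w \<longlonglongrightarrow> metric_proj (op_inverse (\<lambda>x. S x + {T x}) 0) v"
proof -
  note maxS = assms(1) and iter = assms(13) and \<delta>_rec = assms(14)
  have r: "0 < r" "r < 1/2" using assms(8,9) by auto
  obtain l where l: "l > 0" "\<delta> \<longlonglongrightarrow> l"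
    using adaptive_stepsize_limit[OF assms(4,3) r(1) assms(7,11,12) \<delta>_rec] .
  \<comment> \<open>The rule bounds \<open>\<delta> (Suc n)\<close>, whereas
    \<open>y (Suc n)\<close> carries \<open>\<delta> n\<close>. The slack between \<open>r\<close>
    and \<open>\<rho>\<close> absorbs their ratio, which tends to 1 as the limit \<open>l\<close> is
    positive.\<close>
  define \<rho> where "\<rho> = (r + 1/2) / 2"
  have \<rho>: "r < \<rho>" "\<rho> < 1/2" using r by (auto simp: \<rho>_def)
  define y where "y n = \<delta> (n - 1) *\<^sub>R (T (w n) - T (w (n - 1)))" for n
  show ?thesis
  proof (rule halpern_inertial_convergence[where y = y and \<rho> = \<rho> and l = "l / 2" and \<delta> = \<delta> and \<sigma> = \<sigma>])
    show "maximal_monotone_op (\<lambda>x. S x + {T x})"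
      using maximal_monotone_op_plus_lipschitz[OF maxS _ assms(4,3)] assms(2) by blast
    have "\<forall>\<^sub>F n in sequentially. l / 2 < \<delta> n"
      using l by (intro order_tendstoD(1)[OF l(2)]) simp
    then show \<delta>_ge: "\<forall>\<^sub>F n in sequentially. l / 2 \<le> \<delta> n"
      by eventually_elim simp
    show "\<forall>\<^sub>F n in sequentially. \<exists>u\<in>S (w (Suc n)) + {T (w (Suc n))}.
      \<delta> n *\<^sub>R u = \<sigma> n *\<^sub>R v + (1 - \<sigma> n) *\<^sub>R w n - w (Suc n) + y (Suc n) - (1 - \<sigma> n) *\<^sub>R y n"
      using \<delta>_ge eventually_ge_at_top[of 1]
    proof eventually_elim
      case (elim n)
      then have "\<delta> n > 0" using l(1) by linarith
      from resolvent_works[OF maxS this] obtain u where "u \<in> S (w (n + 1))"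
        and "w (n + 1) + \<delta> n *\<^sub>R u = \<sigma> n *\<^sub>R v + (1 - \<sigma> n) *\<^sub>R w n - \<delta> n *\<^sub>R T (w n)
             - (\<delta> (n - 1) * (1 - \<sigma> n)) *\<^sub>R (T (w n) - T (w (n - 1)))"
        using iter elim(2) by metis
      \<comment> \<open>Adding \<open>\<delta> n *\<^sub>R T (w (Suc n))\<close> to both sides
        passes from \<open>S\<close> to the sum operator and completes the forward term to
        \<open>y (Suc n)\<close>.\<close>
      then show ?case
        by (intro bexI[of _ "u + T (w (Suc n))"]) (auto simp: y_def algebra_simps set_plus_def)
    qed
    have "(\<lambda>n. \<rho> * \<delta> (Suc n) - r * \<delta> n) \<longlonglongrightarrow> \<rho> * l - r * l"
      by (intro tendsto_intros l(2) LIMSEQ_Suc)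
    then have "\<forall>\<^sub>F n in sequentially. 0 < \<rho> * \<delta> (Suc n) - r * \<delta> n"
      by (rule order_tendstoD) (use \<rho> l in simp)
    then show "\<forall>\<^sub>F n in sequentially. norm (y (Suc n)) \<le> \<rho> * norm (w (Suc n) - w n)"
      using \<delta>_ge eventually_ge_at_top[of 1]
    proof eventually_elim
      case (elim n)
      let ?d = "norm (w n - w (Suc n))" and ?D = "norm (T (w n) - T (w (Suc n)))"
      have "\<delta> (Suc n) * ?D \<le> r * ?d"
        using \<delta>_rec[rule_format, OF elim(3)] r(1) by (auto simp: min_def field_simps split: if_splits)
      then have "\<rho> * (\<delta> (Suc n) * ?D) \<le> \<rho> * (r * ?d)" using \<rho> r by (intro mult_left_mono) auto
      moreover have "(r * \<delta> n) * ?D \<le> (\<rho> * \<delta> (Suc n)) * ?D" using elim by (intro mult_right_mono) auto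
      ultimately have "r * (\<delta> n * ?D) \<le> r * (\<rho> * ?d)" by (simp add: mult_ac)
      then have "\<delta> n * ?D \<le> \<rho> * ?d" using r(1) by simp
      then show ?case using elim(2) l(1) by (simp add: y_def norm_minus_commute)
    qed
  qed (use assms(5,10,15,16) l \<rho> r in auto)
qed

end
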